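(* Let $n \geq 2$ be an integer, $K$ a field with at least $n$ elements, and $$f(x_1,x_2,x_3)=\sum_{\sigma\in S_3} a_\sigma x_{\sigma(1)}x_{\sigma(2)}x_{\sigma(3)}\in K\langle x_1,x_2,x_3\rangle \qquad (a_\sigma \in K)$$ a nonzero multilinear polynomial of degree $3$. Then $f(\mathbb{M}_n(K))=[\mathbb{M}_n(K),\mathbb{M}_n(K)]$ if and only if $\sum_{\sigma\in S_3}a_\sigma=0=\sum_{\sigma\in A_3}a_\sigma$, where $A_3\subseteq S_3$ is the alternating subgroup.
   Context: $K\langle x_1,x_2,x_3\rangle$ is the free associative unital $K$-algebra on the non-commuting variables $x_1,x_2,x_3$, and $S_3$ is the group of all permutations of $\{1,2,3\}$. $\mathbb{M}_n(K)$ is the algebra of $n\times n$ matrices over $K$, and $f(\mathbb{M}_n(K))=\{f(B_1,B_2,B_3)\mid B_1,B_2,B_3\in\mathbb{M}_n(K)\}$ is the set of values of $f$. $[\mathbb{M}_n(K),\mathbb{M}_n(K)]$ denotes the $K$-subspace of $\mathbb{M}_n(K)$ consisting of the matrices of trace $0$ (equivalently, the additive subgroup generated by all commutators $BC-CB$). *)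

theory Defs
  imports
    "Jordan_Normal_Form.Matrix"
    "HOL-Combinatorics.Permutations"
    "HOL-Library.Poly_Mapping"
    "HOL-Library.Numeral_Type"
begin

text \<open>
  Words over \<open>'x\<close> form the free monoid. It is written additively because the convolution
  product of \<^theory>\<open>HOL-Library.Poly_Mapping\<close> is based on the additive structure of the
  exponents. Thus \<open>('x, 'k) free_algebra\<close> is an instance of \<^class>\<open>ring_1\<close>, and its product is
  induced by concatenation of words.
\<close>

datatype 'x word = Word (letters: "'x list")

instantiation word :: (type) monoid_add
begin

definition zero_word :: "'a word" where
  "0 = Word []"

definition plus_word :: "'a word \<Rightarrow> 'a word \<Rightarrow> 'a word" where
  "u + v = Word (letters u @ letters v)"

instance
  by standard (simp_all add: zero_word_def plus_word_def)

end

type_synonym ('x, 'k) free_algebra = "'x word \<Rightarrow>\<^sub>0 'k"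

definition scalar :: "'k::ring_1 \<Rightarrow> ('x, 'k) free_algebra" where
  "scalar c = Poly_Mapping.single 0 c"

definition var :: "'x \<Rightarrow> ('x, 'k::ring_1) free_algebra" where
  "var i = Poly_Mapping.single (Word [i]) 1"

definition eval_word :: "nat \<Rightarrow> ('x \<Rightarrow> 'k::comm_ring_1 mat) \<Rightarrow> 'x word \<Rightarrow> 'k mat" where
  "eval_word n B w = foldr (\<lambda>i M. B i * M) (letters w) (1\<^sub>m n)"

definition eval_mat :: "nat \<Rightarrow> ('x \<Rightarrow> 'k::comm_ring_1 mat) \<Rightarrow> ('x, 'k) free_algebra \<Rightarrow> 'k mat" where
  "eval_mat n B f =
     mat n n (\<lambda>rc. \<Sum>w\<in>Poly_Mapping.keys f. Poly_Mapping.lookup f w * (eval_word n B w $$ rc))"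

definition mat_values :: "nat \<Rightarrow> ('x, 'k::comm_ring_1) free_algebra \<Rightarrow> 'k mat set" where
  "mat_values n f = {eval_mat n B f | B. \<forall>i. B i \<in> carrier_mat n n}"

definition mat_trace :: "'k::comm_ring_1 mat \<Rightarrow> 'k" where
  "mat_trace A = (\<Sum>i<dim_row A. A $$ (i, i))"

definition trace_zero_mats :: "nat \<Rightarrow> 'k::comm_ring_1 mat set" where
  "trace_zero_mats n = {A \<in> carrier_mat n n. mat_trace A = 0}"

text \<open>
  The three variables are indexed by the numeral type \<open>3\<close>, whose elements are exactly
  \<open>1\<close>, \<open>2\<close> and \<open>3\<close> (where \<open>3 = 0\<close>); its arithmetic plays no role. The permutations of
  \<open>UNIV :: 3 set\<close> thus form the group \<open>S\<^sub>3\<close>, and the even ones form \<open>A\<^sub>3\<close>.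
\<close>

lemma UNIV_3: "(UNIV :: 3 set) = {1, 2, 3}" and distinct_3: "distinct [1, 2, 3 :: 3]"
proof -
  show d: "distinct [1, 2, 3 :: 3]"
    by simp
  have "card {1, 2, 3 :: 3} = 3"
    using distinct_card[OF d] by simp
  then show "(UNIV :: 3 set) = {1, 2, 3}"
    by (intro card_subset_eq[symmetric]) auto
qed

definition multilinear3 :: "((3 \<Rightarrow> 3) \<Rightarrow> 'k::ring_1) \<Rightarrow> (3, 'k) free_algebra" where
  "multilinear3 a = (\<Sum>\<sigma> | \<sigma> permutes UNIV.
     scalar (a \<sigma>) * var (\<sigma> 1) * var (\<sigma> 2) * var (\<sigma> 3))"

end

theory Submission
  imports Defs "Jordan_Normal_Form.Column_Operations"
begin

text \<open>
  Write \<open>f = p xyz + q yzx + r zxy + u yxz + v xzy + w zyx\<close>, so that \<open>p, q, r\<close> belong to the even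
  permutations. Cyclic invariance of the trace gives
  \<open>tr f(X, Y, Z) = (p + q + r) tr(XYZ) + (u + v + w) tr(YXZ)\<close>. Matrix units with
  \<open>XYZ = E\<^sub>0\<^sub>0\<close> and \<open>YXZ = 0\<close> (or vice versa) show that all values have trace zero iff both
  brackets vanish (\<open>mat_trace_cubic\<close>, \<open>coefficient_sums_eq_0\<close>). This is the condition of the
  theorem, because the sum of all coefficients is the sum of the two brackets. It remains to see that under this condition every trace zero matrix is a value.

  The set of values is closed under conjugation (\<open>mat_values_similar\<close>), and every trace zero
  matrix is scalar or similar to a hollow matrix, i.e. one with zero diagonal
  (\<open>trace_zero_similar_hollow_or_scalar\<close>). So only these two kinds of matrices need to be
  represented. Substituting the identity matrix for one variable turns \<open>f\<close> into a multiple of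
  the commutator of the other two, with factor \<open>u - r\<close>, \<open>p - w\<close> or \<open>v - q\<close> (\<open>cubic_one\<close>).

  \<^item> If one of these factors is nonzero, it suffices to write the matrix as a commutator. For a
    hollow matrix one takes commutators with a diagonal matrix with distinct entries, whose existence
    is what the bound on the size of the field provides; for a scalar matrix one uses weighted shifts
    (\<open>trace_zero_commutator\<close>).

  \<^item> If all three factors vanish, then \<open>f = p (xyz + zyx) + q (yzx + xzy) + r (zxy + yxz)\<close> with
    \<open>p + q + r = 0\<close>. Rotating the variables one may assume \<open>p \<noteq> 0\<close>. Now
    \<open>f(D, Y, D) = - p [D, [D, Y]]\<close> yields the hollow matrices for the same \<open>D\<close>, and shifts yield
    the scalar ones again (\<open>trace_zero_symmetric_cubic\<close>).
\<close>

section \<open>Values of a noncommutative polynomial on matrices\<close>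

lemma eval_mat_superset:
  assumes "finite S" "Poly_Mapping.keys f \<subseteq> S"
  shows "eval_mat n B f =
    mat n n (\<lambda>rc. \<Sum>w\<in>S. Poly_Mapping.lookup f w * (eval_word n B w $$ rc))"
proof -
  have "(\<Sum>w\<in>Poly_Mapping.keys f. Poly_Mapping.lookup f w * (eval_word n B w $$ rc)) =
      (\<Sum>w\<in>S. Poly_Mapping.lookup f w * (eval_word n B w $$ rc))" for rc
    using assms by (intro sum.mono_neutral_left) (auto simp: in_keys_iff)
  then show ?thesis
    unfolding eval_mat_def by simp
qed

lemma eval_mat_carrier [simp]: "eval_mat n B f \<in> carrier_mat n n"
  by (simp add: eval_mat_def)

lemma eval_mat_add: "eval_mat n B (f + g) = eval_mat n B f + eval_mat n B g"
proof -
  let ?S = "Poly_Mapping.keys f \<union> Poly_Mapping.keys g"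
  have "Poly_Mapping.keys (f + g) \<subseteq> ?S"
    by (rule Poly_Mapping.keys_add)
  then show ?thesis
    by (intro eq_matI)
      (auto simp: eval_mat_superset[of ?S] lookup_add algebra_simps sum.distrib)
qed

lemma eval_mat_single:
  assumes "eval_word n B w \<in> carrier_mat n n"
  shows "eval_mat n B (Poly_Mapping.single w c) = c \<cdot>\<^sub>m eval_word n B w"
  using assms by (intro eq_matI) (auto simp: eval_mat_superset[of "{w}"])

lemma index_mult_mat_sum:
  assumes "A \<in> carrier_mat n n" "B \<in> carrier_mat n n" "i < n" "j < n"
  shows "(A * B) $$ (i, j) = (\<Sum>k<n. A $$ (i, k) * B $$ (k, j))"
  using assms by (auto simp: scalar_prod_def atLeast0LessThan)

lemma index_mult_mult_mat:
  assumes "P \<in> carrier_mat n n" "M \<in> carrier_mat n n" "Q \<in> carrier_mat n n" "i < n" "j < n"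
  shows "(P * M * Q) $$ (i, j) = (\<Sum>l<n. \<Sum>k<n. P $$ (i, k) * M $$ (k, l) * Q $$ (l, j))"
  using assms
  by (auto simp: scalar_prod_def atLeast0LessThan sum_distrib_right simp del: assoc_mult_mat
      intro!: sum.cong)

lemma eval_word_carrier:
  assumes "\<And>i. B i \<in> carrier_mat n n"
  shows "eval_word n B w \<in> carrier_mat n n"
proof -
  have "foldr (\<lambda>i M. B i * M) xs (1\<^sub>m n) \<in> carrier_mat n n" for xs
    using assms by (induction xs) (auto intro: mult_carrier_mat)
  then show ?thesis
    by (simp add: eval_word_def)
qed

lemma eval_word_conjugate:
  fixes B :: "'x \<Rightarrow> 'k::comm_ring_1 mat"
  assumes "P \<in> carrier_mat n n" "Q \<in> carrier_mat n n" "P * Q = 1\<^sub>m n" "Q * P = 1\<^sub>m n"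
    and B: "\<And>i. B i \<in> carrier_mat n n"
  shows "eval_word n (\<lambda>i. P * B i * Q) w = P * eval_word n B w * Q"
proof -
  have "foldr (\<lambda>i M. P * B i * Q * M) xs (1\<^sub>m n) = P * foldr (\<lambda>i M. B i * M) xs (1\<^sub>m n) * Q" for xs
  proof (induction xs)
    case Nil
    then show ?case
      using assms by simp
  next
    case (Cons x xs)
    let ?M = "foldr (\<lambda>i M. B i * M) xs (1\<^sub>m n)"
    have M: "?M \<in> carrier_mat n n"
      using eval_word_carrier[of B n "Word xs"] B by (simp add: eval_word_def)
    have "P * B x * Q * (P * ?M * Q) = P * B x * (Q * P) * ?M * Q"
      using assms(1,2) B[of x] M by (simp add: assoc_mult_mat[of _ n n _ n _ n])
    also have "P * B x * (Q * P) = P * B x"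
      using assms(1,4) B[of x] by (simp del: assoc_mult_mat)
    also have "P * B x * ?M * Q = P * (B x * ?M) * Q"
      using assms(1,2) B[of x] M by (simp add: assoc_mult_mat[of _ n n _ n _ n])
    finally show ?case
      using Cons.IH by simp
  qed
  then show ?thesis
    by (simp add: eval_word_def)
qed

lemma eval_mat_conjugate:
  fixes B :: "'x \<Rightarrow> 'k::comm_ring_1 mat"
  assumes PQ: "P \<in> carrier_mat n n" "Q \<in> carrier_mat n n" "P * Q = 1\<^sub>m n" "Q * P = 1\<^sub>m n"
    and B: "\<And>i. B i \<in> carrier_mat n n"
  shows "eval_mat n (\<lambda>i. P * B i * Q) f = P * eval_mat n B f * Q"
proof (rule eq_matI)
  fix i j
  assume "i < dim_row (P * eval_mat n B f * Q)" "j < dim_col (P * eval_mat n B f * Q)"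
  then have ij: "i < n" "j < n"
    using PQ by auto
  let ?c = "Poly_Mapping.lookup f" and ?E = "eval_word n B"
  have "eval_mat n (\<lambda>i. P * B i * Q) f $$ (i, j) =
      (\<Sum>w\<in>Poly_Mapping.keys f. ?c w * (\<Sum>l<n. \<Sum>k<n. P $$ (i, k) * ?E w $$ (k, l) * Q $$ (l, j)))"
    using ij index_mult_mult_mat[OF PQ(1) eval_word_carrier[of B n, OF B] PQ(2) ij]
    by (simp add: eval_mat_def eval_word_conjugate[OF PQ B])
  also have "\<dots> = (\<Sum>l<n. \<Sum>k<n. \<Sum>w\<in>Poly_Mapping.keys f.
      ?c w * (P $$ (i, k) * ?E w $$ (k, l) * Q $$ (l, j)))"
    unfolding sum_distrib_left
    by (subst sum.swap, rule sum.cong[OF refl], rule sum.swap)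
  also have "\<dots> = (\<Sum>l<n. \<Sum>k<n. P $$ (i, k) * eval_mat n B f $$ (k, l) * Q $$ (l, j))"
    by (intro sum.cong refl) (simp add: eval_mat_def sum_distrib_left sum_distrib_right ac_simps)
  also have "\<dots> = (P * eval_mat n B f * Q) $$ (i, j)"
    by (rule index_mult_mult_mat[OF PQ(1) eval_mat_carrier PQ(2) ij, symmetric])
  finally show "eval_mat n (\<lambda>i. P * B i * Q) f $$ (i, j) = (P * eval_mat n B f * Q) $$ (i, j)" .
qed (use PQ in \<open>auto simp: eval_mat_def\<close>)

text \<open>Evaluation of polynomials commutes with the simultaneous conjugation of all arguments, since conjugation is
  an algebra automorphism.\<close>

lemma mat_values_similar:
  assumes "similar_mat A A'" "A' \<in> mat_values n f"
  shows "A \<in> mat_values n f"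
proof -
  obtain B where B: "\<And>i. B i \<in> carrier_mat n n" and A': "A' = eval_mat n B f"
    using assms(2) by (auto simp: mat_values_def)
  obtain m P Q where PQ: "{A, A', P, Q} \<subseteq> carrier_mat m m" "P * Q = 1\<^sub>m m" "Q * P = 1\<^sub>m m"
    "A = P * A' * Q"
    using similar_matD[OF assms(1)] by blast
  have "A' \<in> carrier_mat n n" "A' \<in> carrier_mat m m"
    using PQ(1) by (simp_all add: A')
  then have m: "m = n"
    by (metis carrier_matD(1))
  then have carr: "P \<in> carrier_mat n n" "Q \<in> carrier_mat n n"
    using PQ(1) by auto
  have "A = eval_mat n (\<lambda>i. P * B i * Q) f"
    unfolding PQ(4) A'
    by (rule eval_mat_conjugate[where B = B, OF carr PQ(2,3)[unfolded m] B, symmetric])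
  moreover have "P * B i * Q \<in> carrier_mat n n" for i
    using mult_carrier_mat[OF mult_carrier_mat[OF carr(1) B] carr(2)] .
  ultimately show ?thesis
    unfolding mat_values_def mem_Collect_eq by blast
qed

section \<open>Multilinear polynomials of degree three\<close>

text \<open>With these transpositions, the sequence \<open>\<sigma> 1, \<sigma> 2, \<sigma> 3\<close> reads \<open>2, 3, 1\<close> for \<open>t12 \<circ> t23\<close> and
  \<open>3, 1, 2\<close> for \<open>t23 \<circ> t12\<close>.\<close>

abbreviation t12 :: "3 \<Rightarrow> 3" where "t12 \<equiv> transpose 1 2"
abbreviation t13 :: "3 \<Rightarrow> 3" where "t13 \<equiv> transpose 1 3"
abbreviation t23 :: "3 \<Rightarrow> 3" where "t23 \<equiv> transpose 2 3"

lemma distinct_numerals_3 [simp]: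
  "(1::3) \<noteq> 2" "(2::3) \<noteq> 1" "(1::3) \<noteq> 3" "(3::3) \<noteq> 1" "(2::3) \<noteq> 3" "(3::3) \<noteq> 2"
  using distinct_3 by auto

lemma permutations_3:
  "{\<sigma> :: 3 \<Rightarrow> 3. \<sigma> permutes UNIV} = {id, t12 \<circ> t23, t23 \<circ> t12, t12, t23, t13}"
  "distinct [id, t12 \<circ> t23, t23 \<circ> t12, t12, t23, t13]"
proof -
  show d: "distinct [id, t12 \<circ> t23, t23 \<circ> t12, t12, t23, t13]"
    by (rule distinct_map[THEN iffD1, THEN conjunct1, of "\<lambda>\<sigma>. (\<sigma> 1, \<sigma> 2)"])
      (simp add: transpose_def)
  show "{\<sigma> :: 3 \<Rightarrow> 3. \<sigma> permutes UNIV} = {id, t12 \<circ> t23, t23 \<circ> t12, t12, t23, t13}"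
  proof (rule card_subset_eq[symmetric])
    have "card {\<sigma> :: 3 \<Rightarrow> 3. \<sigma> permutes UNIV} = 6"
      by (subst card_permutations[OF refl]) (simp_all add: fact_numeral)
    then show "card {id, t12 \<circ> t23, t23 \<circ> t12, t12, t23, t13} = card {\<sigma> :: 3 \<Rightarrow> 3. \<sigma> permutes UNIV}"
      using distinct_card[OF d] by simp
  qed (auto intro!: permutes_swap_id permutes_compose permutes_id)
qed

lemma sum_permutations_3:
  fixes g :: "(3 \<Rightarrow> 3) \<Rightarrow> 'b::comm_monoid_add"
  shows "(\<Sum>\<sigma> | \<sigma> permutes UNIV. g \<sigma>) =
    g id + (g (t12 \<circ> t23) + (g (t23 \<circ> t12) + (g t12 + (g t23 + g t13))))"
  using permutations_3(2) unfolding permutations_3(1) by simp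

lemma sum_even_permutations_3:
  fixes g :: "(3 \<Rightarrow> 3) \<Rightarrow> 'b::comm_monoid_add"
  shows "(\<Sum>\<sigma> | \<sigma> permutes UNIV \<and> evenperm \<sigma>. g \<sigma>) = g id + (g (t12 \<circ> t23) + g (t23 \<circ> t12))"
proof -
  have "{\<sigma> :: 3 \<Rightarrow> 3. \<sigma> permutes UNIV \<and> evenperm \<sigma>} = {\<sigma>. \<sigma> permutes UNIV} \<inter> {\<sigma>. evenperm \<sigma>}"
    by auto
  also have "\<dots> = {id, t12 \<circ> t23, t23 \<circ> t12}"
    unfolding permutations_3(1)
    by (auto simp: evenperm_swap evenperm_comp permutation_swap_id)
  finally show ?thesis
    using permutations_3(2) by simp
qed

text \<open>Explicit coefficients instead of a function on permutations make it possible to permute the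
  variables by permuting the six parameters. The first three belong to the even permutations.\<close>

definition cubic ::
  "nat \<Rightarrow> 'k \<Rightarrow> 'k \<Rightarrow> 'k \<Rightarrow> 'k \<Rightarrow> 'k \<Rightarrow> 'k \<Rightarrow> 'k mat \<Rightarrow> 'k mat \<Rightarrow> 'k mat \<Rightarrow> 'k::comm_ring_1 mat" where
  "cubic n p q r u v w X Y Z = mat n n (\<lambda>ij.
     p * (X * Y * Z) $$ ij + q * (Y * Z * X) $$ ij + r * (Z * X * Y) $$ ij +
     u * (Y * X * Z) $$ ij + v * (X * Z * Y) $$ ij + w * (Z * Y * X) $$ ij)"

abbreviation cubic_of ::
  "nat \<Rightarrow> ((3 \<Rightarrow> 3) \<Rightarrow> 'k) \<Rightarrow> 'k mat \<Rightarrow> 'k mat \<Rightarrow> 'k mat \<Rightarrow> 'k::comm_ring_1 mat" where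
  "cubic_of n a \<equiv>
     cubic n (a id) (a (t12 \<circ> t23)) (a (t23 \<circ> t12)) (a t12) (a t23) (a t13)"

lemma monomial_eq_single:
  "scalar c * var i * var j * var k = Poly_Mapping.single (Word [i, j, k]) (c :: 'k::comm_ring_1)"
  by (simp add: scalar_def var_def mult_single plus_word_def zero_word_def)

lemma eval_mat_multilinear3:
  fixes a :: "(3 \<Rightarrow> 3) \<Rightarrow> 'k::comm_ring_1"
  assumes B: "\<And>i. B i \<in> carrier_mat n n"
  shows "eval_mat n B (multilinear3 a) = cubic_of n a (B 1) (B 2) (B 3)"
proof -
  have w: "eval_word n B (Word [i, j, k]) = B i * B j * B k" for i j k
    using B[of i] B[of j] B[of k]
    by (simp add: eval_word_def assoc_mult_mat[of _ n n _ n _ n])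
  have s: "eval_mat n B (Poly_Mapping.single (Word [i, j, k]) c) = c \<cdot>\<^sub>m (B i * B j * B k)" for i j k c
    using eval_mat_single[OF eval_word_carrier[of B n, OF B], of "Word [i, j, k]" c] by (simp add: w)
  have t: "t12 1 = 2" "t12 2 = 1" "t12 3 = 3" "t13 1 = 3" "t13 2 = 2" "t13 3 = 1"
    "t23 1 = 1" "t23 2 = 3" "t23 3 = 2"
    by (simp_all add: transpose_def)
  have dims: "dim_row (B i) = n" "dim_col (B i) = n" for i
    using B[of i] by auto
  have "eval_mat n B (multilinear3 a) =
      a id \<cdot>\<^sub>m (B 1 * B 2 * B 3) + (a (t12 \<circ> t23) \<cdot>\<^sub>m (B 2 * B 3 * B 1) +
      (a (t23 \<circ> t12) \<cdot>\<^sub>m (B 3 * B 1 * B 2) + (a t12 \<cdot>\<^sub>m (B 2 * B 1 * B 3) +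
      (a t23 \<cdot>\<^sub>m (B 1 * B 3 * B 2) + a t13 \<cdot>\<^sub>m (B 3 * B 2 * B 1)))))"
    unfolding multilinear3_def monomial_eq_single sum_permutations_3 eval_mat_add s o_apply id_apply t ..
  then show ?thesis
    by (auto intro!: eq_matI simp: cubic_def dims add.assoc simp del: index_mult_mat(1))
qed

lemma cubic_in_mat_values:
  assumes "X \<in> carrier_mat n n" "Y \<in> carrier_mat n n" "Z \<in> carrier_mat n n"
  shows "cubic_of n a X Y Z \<in> mat_values n (multilinear3 a)"
proof -
  define B where "B i = (if i = 1 then X else if i = 2 then Y else Z)" for i :: 3
  have "\<And>i. B i \<in> carrier_mat n n"
    using assms by (simp add: B_def)
  moreover from this have "eval_mat n B (multilinear3 a) = cubic_of n a X Y Z"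
    by (subst eval_mat_multilinear3) (simp_all add: B_def)
  ultimately show ?thesis
    unfolding mat_values_def mem_Collect_eq by (intro exI[of _ B]) simp
qed

lemma multilinear3_eq_0:
  assumes "a id = 0" "a (t12 \<circ> t23) = 0" "a (t23 \<circ> t12) = 0" "a t12 = 0" "a t23 = 0" "a t13 = 0"
  shows "multilinear3 a = (0 :: (3, 'k::comm_ring_1) free_algebra)"
  using assms unfolding multilinear3_def sum_permutations_3 by (simp add: scalar_def)

section \<open>Traces\<close>

lemma mat_trace_mult_comm:
  fixes A B :: "'k::comm_ring_1 mat"
  assumes "A \<in> carrier_mat n n" "B \<in> carrier_mat n n"
  shows "mat_trace (A * B) = mat_trace (B * A)"
proof -
  have "mat_trace (A * B) = (\<Sum>i<n. \<Sum>k<n. A $$ (i, k) * B $$ (k, i))"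
    using assms by (auto simp: mat_trace_def scalar_prod_def atLeast0LessThan)
  also have "\<dots> = (\<Sum>i<n. \<Sum>k<n. B $$ (i, k) * A $$ (k, i))"
    by (subst sum.swap) (simp add: mult.commute)
  also have "\<dots> = mat_trace (B * A)"
    using assms by (auto simp: mat_trace_def scalar_prod_def atLeast0LessThan)
  finally show ?thesis .
qed

lemma mat_trace_similar:
  fixes A A' :: "'k::comm_ring_1 mat"
  assumes "similar_mat A A'"
  shows "mat_trace A = mat_trace A'"
proof -
  obtain m P Q where PQ: "{A, A', P, Q} \<subseteq> carrier_mat m m" "Q * P = 1\<^sub>m m" "A = P * A' * Q"
    using similar_matD[OF assms] by blast
  then have "mat_trace A = mat_trace (P * (A' * Q))"
    by (simp add: assoc_mult_mat[of _ m m _ m _ m])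
  also have "\<dots> = mat_trace (A' * Q * P)"
    using PQ(1) by (intro mat_trace_mult_comm[of _ m]) auto
  also have "A' * Q * P = A'"
    using PQ(1,2) right_mult_one_mat[of A' m m]
    by (simp add: assoc_mult_mat[of _ m m _ m _ m] del: right_mult_one_mat)
  finally show ?thesis .
qed

lemma mat_trace_cubic:
  fixes X Y Z :: "'k::comm_ring_1 mat"
  assumes [simp]: "X \<in> carrier_mat n n" "Y \<in> carrier_mat n n" "Z \<in> carrier_mat n n"
  shows "mat_trace (cubic n p q r u v w X Y Z) =
    (p + q + r) * mat_trace (X * Y * Z) + (u + v + w) * mat_trace (Y * X * Z)"
proof -
  have rot: "mat_trace (A * B * C) = mat_trace (B * C * A)"
    if "A \<in> carrier_mat n n" "B \<in> carrier_mat n n" "C \<in> carrier_mat n n" for A B C :: "'k mat"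
    using that mat_trace_mult_comm[of A n "B * C"] by (simp add: assoc_mult_mat[of _ n n _ n _ n])
  have carr: "A * B * C \<in> carrier_mat n n"
    if "A \<in> carrier_mat n n" "B \<in> carrier_mat n n" "C \<in> carrier_mat n n" for A B C :: "'k mat"
    using that by auto
  have tr: "(\<Sum>i<n. M $$ (i, i)) = mat_trace M" if "M \<in> carrier_mat n n" for M :: "'k mat"
    using that by (auto simp: mat_trace_def)
  have "mat_trace (cubic n p q r u v w X Y Z) =
      p * mat_trace (X * Y * Z) + q * mat_trace (Y * Z * X) + r * mat_trace (Z * X * Y) +
      u * mat_trace (Y * X * Z) + v * mat_trace (X * Z * Y) + w * mat_trace (Z * Y * X)"
    unfolding tr[OF carr, symmetric, OF assms(1-3)]
      tr[OF carr, symmetric, OF assms(2,3,1)] tr[OF carr, symmetric, OF assms(3,1,2)]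
      tr[OF carr, symmetric, OF assms(2,1,3)] tr[OF carr, symmetric, OF assms(1,3,2)]
      tr[OF carr, symmetric, OF assms(3,2,1)]
    by (simp add: mat_trace_def cubic_def sum.distrib sum_distrib_left del: index_mult_mat(1))
  also have "\<dots> = (p + q + r) * mat_trace (X * Y * Z) + (u + v + w) * mat_trace (Y * X * Z)"
    unfolding rot[OF assms(2,3,1)] rot[OF assms(3,1,2)] rot[OF assms(1,3,2)] rot[OF assms(3,2,1)]
    by (simp only: algebra_simps)
  finally show ?thesis .
qed

section \<open>Trace zero matrices up to similarity\<close>

definition hollow_mats :: "nat \<Rightarrow> 'k::zero mat set" where
  "hollow_mats n = {A \<in> carrier_mat n n. \<forall>i<n. A $$ (i, i) = 0}"

text \<open>
  \<open>nonscalar_on S A\<close> says that the principal submatrix of \<open>A\<close> with index set \<open>S\<close> is not scalar.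
  Diagonal entries are made zero one by one by elementary conjugations inside \<open>S\<close>, which fix the
  diagonal entries outside \<open>S\<close>; the finished index is then removed from \<open>S\<close>. Working with
  arbitrary index sets avoids permuting rows and columns into block form.

  Conjugation by \<open>add_col_sub_row c k l\<close> subtracts \<open>c\<close> times row \<open>l\<close> from row \<open>k\<close> and adds \<open>c\<close> times
  column \<open>k\<close> to column \<open>l\<close>. Of the diagonal, it changes only the entries \<open>k\<close> and \<open>l\<close>.
\<close>

definition nonscalar_on :: "nat set \<Rightarrow> 'k::zero mat \<Rightarrow> bool" where
  "nonscalar_on S A \<longleftrightarrow> (\<exists>i\<in>S. \<exists>j\<in>S. i \<noteq> j \<and> (A $$ (i, j) \<noteq> 0 \<or> A $$ (i, i) \<noteq> A $$ (j, j)))"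

text \<open>If there is no pivot already, the submatrix is diagonal with two distinct entries, and adding one
  row to another produces their difference off the diagonal.\<close>

lemma offdiagonal_pivot:
  fixes A :: "'k::field mat"
  assumes A: "A \<in> carrier_mat n n" and S: "S \<subseteq> {..<n}" and ns: "nonscalar_on S A"
  obtains A' i j where "similar_mat A' A" "A' \<in> carrier_mat n n" "i \<in> S" "j \<in> S" "i \<noteq> j"
    "A' $$ (j, i) \<noteq> 0" "\<And>k. k \<in> {..<n} - S \<Longrightarrow> A' $$ (k, k) = A $$ (k, k)"
proof (cases "\<exists>i\<in>S. \<exists>j\<in>S. i \<noteq> j \<and> A $$ (j, i) \<noteq> 0")
  case True
  then show ?thesis
    using that[of A] similar_mat_refl[OF A] A by blast
next
  case False
  then obtain i j where ij: "i \<in> S" "j \<in> S" "i \<noteq> j" "A $$ (i, i) \<noteq> A $$ (j, j)"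
    using ns by (auto simp: nonscalar_on_def)
  have lt: "i < n" "j < n"
    using ij S by auto
  let ?A' = "add_col_sub_row 1 j i A"
  show ?thesis
  proof (rule that[of ?A' i j])
    show "similar_mat ?A' A"
      using ij lt by (intro add_col_sub_row_similar[OF A]) auto
    show "?A' \<in> carrier_mat n n"
      using A by simp
    have "A $$ (i, j) = 0" "A $$ (j, i) = 0"
      using False ij by auto
    then show "?A' $$ (j, i) \<noteq> 0"
      using ij lt A by auto
    show "?A' $$ (k, k) = A $$ (k, k)" if "k \<in> {..<n} - S" for k
      using that ij lt A by auto
  qed (use ij in auto)
qed

text \<open>Subtracting a multiple of the pivot row \<open>j\<close> from row \<open>i\<close> clears the entry \<open>(i, i)\<close>. The
  conjugation changes only row \<open>i\<close> and column \<open>j\<close>, so the pivot \<open>(j, i)\<close> survives.\<close>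

lemma zero_diagonal_entry:
  fixes A :: "'k::field mat"
  assumes A: "A \<in> carrier_mat n n" and S: "S \<subseteq> {..<n}" and ns: "nonscalar_on S A"
  obtains A' i j where "similar_mat A' A" "A' \<in> carrier_mat n n" "i \<in> S" "j \<in> S" "i \<noteq> j"
    "A' $$ (j, i) \<noteq> 0" "A' $$ (i, i) = 0" "\<And>k. k \<in> {..<n} - S \<Longrightarrow> A' $$ (k, k) = A $$ (k, k)"
proof -
  obtain B i j where B: "similar_mat B A" "B \<in> carrier_mat n n" "i \<in> S" "j \<in> S" "i \<noteq> j"
    "B $$ (j, i) \<noteq> 0" "\<And>k. k \<in> {..<n} - S \<Longrightarrow> B $$ (k, k) = A $$ (k, k)"
    using offdiagonal_pivot[OF assms] by metis
  have lt: "i < n" "j < n"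
    using B S by auto
  let ?A' = "add_col_sub_row (B $$ (i, i) / B $$ (j, i)) i j B"
  show ?thesis
  proof (rule that[of ?A' i j])
    show "similar_mat ?A' A"
      using similar_mat_trans[OF add_col_sub_row_similar[OF B(2) lt B(5)] B(1)] .
    show "?A' $$ (k, k) = A $$ (k, k)" if "k \<in> {..<n} - S" for k
      using that B lt by auto
  qed (use B lt in auto)
qed

text \<open>The procedure can only continue if the submatrix that remains after removing \<open>i\<close> is not scalar.
  If it is scalar, the pivot in column \<open>i\<close> can be used to destroy this: subtracting row \<open>l\<close>
  from row \<open>i\<close> adds column \<open>i\<close> to column \<open>l\<close>, which moves the pivot to the off-diagonal position
  \<open>(j, l)\<close>. The entry \<open>(i, i)\<close> stays zero only if \<open>(l, i)\<close> is zero, so that entry is cleared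
  beforehand; a scalar submatrix does not notice this.\<close>

lemma nonscalar_on_remainder:
  fixes A :: "'k::field mat"
  assumes A: "A \<in> carrier_mat n n" and S: "S \<subseteq> {..<n}"
    and ijl: "i \<in> S" "j \<in> S" "l \<in> S" "i \<noteq> j" "i \<noteq> l" "j \<noteq> l"
    and ji: "A $$ (j, i) \<noteq> 0" and ii: "A $$ (i, i) = 0"
  obtains A' where "similar_mat A' A" "A' \<in> carrier_mat n n" "A' $$ (i, i) = 0"
    "nonscalar_on (S - {i}) A'" "\<And>k. k \<in> {..<n} - S \<Longrightarrow> A' $$ (k, k) = A $$ (k, k)"
proof (cases "nonscalar_on (S - {i}) A")
  case True
  then show ?thesis
    using that[of A] similar_mat_refl[OF A] A ii by blast
next
  case False
  have lt: "i < n" "j < n" "l < n"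
    using ijl S by auto
  have "A $$ (x, y) = 0 \<and> A $$ (x, x) = A $$ (y, y)" if "x \<in> S - {i}" "y \<in> S - {i}" "x \<noteq> y" for x y
    using False that unfolding nonscalar_on_def by blast
  from this[of j l] this[of l j]
  have sc: "A $$ (j, l) = 0" "A $$ (l, j) = 0" "A $$ (l, l) = A $$ (j, j)"
    using ijl by auto
  let ?B = "add_col_sub_row (A $$ (l, i) / A $$ (j, i)) l j A"
  have B: "?B \<in> carrier_mat n n"
    using A by simp
  have Bij: "?B $$ (l, i) = 0" "?B $$ (j, i) = A $$ (j, i)" "?B $$ (j, l) = 0" "?B $$ (i, i) = 0"
    using A lt ijl ji ii sc by auto
  let ?A' = "add_col_sub_row 1 i l ?B"
  show ?thesis
  proof (rule that[of ?A'])
    show "similar_mat ?A' A"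
      using similar_mat_trans[OF add_col_sub_row_similar[OF B] add_col_sub_row_similar[OF A]]
        lt ijl by auto
    show "?A' \<in> carrier_mat n n"
      using B by simp
    show "?A' $$ (i, i) = 0"
      using B lt ijl Bij by (subst add_col_sub_index_row) auto
    have "?A' $$ (j, l) \<noteq> 0"
      using B lt ijl Bij ji by (subst add_col_sub_index_row) auto
    then show "nonscalar_on (S - {i}) ?A'"
      using ijl by (auto simp: nonscalar_on_def)
    show "?A' $$ (k, k) = A $$ (k, k)" if "k \<in> {..<n} - S" for k
      using that A lt ijl by auto
  qed
qed

lemma hollow_except_one:
  fixes A :: "'k::field mat"
  assumes "finite S" "S \<subseteq> {..<n}" "A \<in> carrier_mat n n" "nonscalar_on S A"
  shows "\<exists>A' s. similar_mat A' A \<and> A' \<in> carrier_mat n n \<and> s \<in> S \<and>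
    (\<forall>k\<in>S - {s}. A' $$ (k, k) = 0) \<and> (\<forall>k\<in>{..<n} - S. A' $$ (k, k) = A $$ (k, k))"
  using assms
proof (induction S arbitrary: A rule: finite_psubset_induct)
  case (psubset S)
  obtain B i j where B: "similar_mat B A" "B \<in> carrier_mat n n" "i \<in> S" "j \<in> S" "i \<noteq> j"
    "B $$ (j, i) \<noteq> 0" "B $$ (i, i) = 0" "\<And>k. k \<in> {..<n} - S \<Longrightarrow> B $$ (k, k) = A $$ (k, k)"
    using zero_diagonal_entry[OF psubset.prems(2,1,3)] by metis
  show ?case
  proof (cases "S = {i, j}")
    case True
    then show ?thesis
      using B by (intro exI[of _ B] exI[of _ j]) auto
  next
    case False
    then obtain l where l: "l \<in> S" "i \<noteq> l" "j \<noteq> l"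
      using B by auto
    obtain C where C: "similar_mat C B" "C \<in> carrier_mat n n" "C $$ (i, i) = 0"
      "nonscalar_on (S - {i}) C" "\<And>k. k \<in> {..<n} - S \<Longrightarrow> C $$ (k, k) = B $$ (k, k)"
      using nonscalar_on_remainder[OF B(2) psubset.prems(1) B(3,4) l(1) B(5) l(2,3) B(6,7)] by metis
    have "S - {i} \<subset> S" "S - {i} \<subseteq> {..<n}"
      using B psubset.prems by auto
    then obtain A' s where A': "similar_mat A' C" "A' \<in> carrier_mat n n" "s \<in> S - {i}"
      "\<forall>k\<in>S - {i} - {s}. A' $$ (k, k) = 0" "\<forall>k\<in>{..<n} - (S - {i}). A' $$ (k, k) = C $$ (k, k)"
      using psubset.IH[OF _ _ C(2,4)] by blast
    have "i < n"
      using B psubset.prems by auto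
    then have "A' $$ (i, i) = 0"
      using A' C by auto
    then show ?thesis
      using A' B C similar_mat_trans[OF A'(1) similar_mat_trans[OF C(1) B(1)]]
      by (intro exI[of _ A'] exI[of _ s]) auto
  qed
qed

text \<open>When all diagonal entries but one have been made zero, the last one is the trace.\<close>

lemma trace_zero_similar_hollow_or_scalar:
  fixes A :: "'k::field mat"
  assumes "n > 0" and A: "A \<in> trace_zero_mats n"
  obtains A' where "similar_mat A A'" "A' \<in> hollow_mats n"
  | c where "A = c \<cdot>\<^sub>m 1\<^sub>m n" "of_nat n * c = 0"
proof (cases "nonscalar_on {..<n} A")
  case True
  have carr: "A \<in> carrier_mat n n" and tr: "mat_trace A = 0"
    using A by (auto simp: trace_zero_mats_def)
  obtain A' s where A': "similar_mat A' A" "A' \<in> carrier_mat n n" "s < n"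
    "\<forall>k\<in>{..<n} - {s}. A' $$ (k, k) = 0"
    using hollow_except_one[OF _ _ carr True] by auto
  have "0 = (\<Sum>k<n. A' $$ (k, k))"
    using mat_trace_similar[OF A'(1)] tr A'(2) by (auto simp: mat_trace_def)
  also have "\<dots> = A' $$ (s, s) + (\<Sum>k\<in>{..<n} - {s}. A' $$ (k, k))"
    using A'(3) by (subst sum.remove[of _ s]) auto
  also have "\<dots> = A' $$ (s, s)"
    using A'(4) by simp
  finally have "A' $$ (k, k) = 0" if "k < n" for k
    using A'(4) that by (cases "k = s") auto
  then have "A' \<in> hollow_mats n"
    using A'(2) by (simp add: hollow_mats_def)
  then show ?thesis
    using that(1) similar_mat_sym[OF A'(1)] by blast
next
  case False
  have carr: "A \<in> carrier_mat n n" and tr: "mat_trace A = 0"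
    using A by (auto simp: trace_zero_mats_def)
  define c where "c = A $$ (0, 0)"
  have diag: "A $$ (i, i) = c" if "i < n" for i
    using False that assms(1) unfolding nonscalar_on_def c_def by (metis lessThan_iff)
  have "A $$ (i, j) = 0" if "i < n" "j < n" "i \<noteq> j" for i j
    using False that unfolding nonscalar_on_def by blast
  then have "A = c \<cdot>\<^sub>m 1\<^sub>m n"
    using carr diag by (intro eq_matI) auto
  moreover have "of_nat n * c = 0"
    using tr carr diag by (simp add: mat_trace_def)
  ultimately show ?thesis
    using that(2) by blast
qed

section \<open>Representing hollow and scalar matrices\<close>

lemma ex_inj_on_lessThan:
  assumes "infinite (UNIV :: 'k set) \<or> n \<le> card (UNIV :: 'k set)"
  obtains d :: "nat \<Rightarrow> 'k" where "inj_on d {..<n}"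
proof -
  obtain T :: "'k set" where T: "finite T" "card T = n"
    using assms infinite_arbitrarily_large obtain_subset_with_card_n by metis
  then obtain d where "bij_betw d {0..<n} T"
    using ex_bij_betw_nat_finite[OF T(1)] by auto
  then show ?thesis
    using that by (auto simp: bij_betw_def atLeast0LessThan)
qed

text \<open>Products that contain one lower shift, one weighted upper shift and diagonal matrices are
  diagonal, so the values of \<open>f\<close> on such matrices can be read off from the weights.\<close>

definition lower_shift :: "nat \<Rightarrow> 'k::zero_neq_one mat" where
  "lower_shift n = mat n n (\<lambda>(i, j). if i = Suc j then 1 else 0)"

definition upper_shift :: "nat \<Rightarrow> (nat \<Rightarrow> 'k) \<Rightarrow> 'k::zero mat" where
  "upper_shift n z = mat n n (\<lambda>(i, j). if j = Suc i then z i else 0)"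

lemma shift_carrier [simp]:
  "lower_shift n \<in> carrier_mat n n" "upper_shift n z \<in> carrier_mat n n"
  by (simp_all add: lower_shift_def upper_shift_def)

lemma mat_diag_upper_shift:
  fixes z :: "nat \<Rightarrow> 'k::comm_ring_1"
  shows "mat_diag n d * upper_shift n z = upper_shift n (\<lambda>i. d i * z i)"
    "upper_shift n z * mat_diag n d = upper_shift n (\<lambda>i. z i * d (Suc i))"
  by (rule eq_matI, auto simp: mat_diag_mult_left[of _ n n] mat_diag_mult_right[of _ n n] upper_shift_def)+

lemma lower_upper_shift:
  fixes z :: "nat \<Rightarrow> 'k::comm_ring_1"
  shows "lower_shift n * upper_shift n z = mat_diag n (\<lambda>i. if i = 0 then 0 else z (i - 1))"
proof (rule eq_matI)
  fix i j
  assume "i < dim_row (mat_diag n (\<lambda>i. if i = 0 then 0 else z (i - 1)))"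
    "j < dim_col (mat_diag n (\<lambda>i. if i = 0 then 0 else z (i - 1)))"
  then have ij: "i < n" "j < n"
    by (auto simp: mat_diag_def)
  have "(lower_shift n * upper_shift n z) $$ (i, j) =
      (\<Sum>k<n. lower_shift n $$ (i, k) * upper_shift n z $$ (k, j))"
    using ij by (rule index_mult_mat_sum[OF shift_carrier])
  also have "\<dots> = (\<Sum>k<n. if k = i - 1 then (if 0 < i \<and> j = i then z k else 0) else 0)"
    using ij by (intro sum.cong) (auto simp: lower_shift_def upper_shift_def)
  also have "\<dots> = mat_diag n (\<lambda>i. if i = 0 then 0 else z (i - 1)) $$ (i, j)"
    using ij by (subst sum.delta) (auto simp: mat_diag_def)
  finally show "(lower_shift n * upper_shift n z) $$ (i, j) =
    mat_diag n (\<lambda>i. if i = 0 then 0 else z (i - 1)) $$ (i, j)" .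
qed (auto simp: lower_shift_def upper_shift_def mat_diag_def)

lemma upper_lower_shift:
  fixes z :: "nat \<Rightarrow> 'k::comm_ring_1"
  shows "upper_shift n z * lower_shift n = mat_diag n (\<lambda>i. if Suc i < n then z i else 0)"
proof (rule eq_matI)
  fix i j
  assume "i < dim_row (mat_diag n (\<lambda>i. if Suc i < n then z i else 0))"
    "j < dim_col (mat_diag n (\<lambda>i. if Suc i < n then z i else 0))"
  then have ij: "i < n" "j < n"
    by (auto simp: mat_diag_def)
  have "(upper_shift n z * lower_shift n) $$ (i, j) =
      (\<Sum>k<n. upper_shift n z $$ (i, k) * lower_shift n $$ (k, j))"
    using ij by (rule index_mult_mat_sum[OF shift_carrier(2,1)])
  also have "\<dots> = (\<Sum>k<n. if k = Suc i then (if i = j then z i else 0) else 0)"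
    using ij by (intro sum.cong) (auto simp: lower_shift_def upper_shift_def)
  also have "\<dots> = mat_diag n (\<lambda>i. if Suc i < n then z i else 0) $$ (i, j)"
    using ij by (subst sum.delta) (auto simp: mat_diag_def)
  finally show "(upper_shift n z * lower_shift n) $$ (i, j) =
    mat_diag n (\<lambda>i. if Suc i < n then z i else 0) $$ (i, j)" .
qed (auto simp: lower_shift_def upper_shift_def mat_diag_def)

text \<open>The commutator with \<open>diag(d\<^sub>0, d\<^sub>1, \<dots>)\<close> multiplies the entry \<open>(i, j)\<close> by \<open>d\<^sub>i - d\<^sub>j\<close>, which can be
  undone off the diagonal. The commutator of an upper shift with weights \<open>z\<^sub>i\<close> and the lower shift is
  diagonal with entries \<open>z\<^sub>i - z\<^bsub>i-1\<^esub>\<close>, so weights in arithmetic progression give a scalar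
  matrix.\<close>

lemma trace_zero_commutator:
  fixes A :: "'k::field mat"
  assumes "infinite (UNIV :: 'k set) \<or> n \<le> card (UNIV :: 'k set)"
    and A: "A \<in> hollow_mats n \<or> (\<exists>c. A = c \<cdot>\<^sub>m 1\<^sub>m n \<and> of_nat n * c = 0)"
  obtains X Y where "X \<in> carrier_mat n n" "Y \<in> carrier_mat n n" "A = X * Y - Y * X"
  using A
proof (elim disjE exE conjE)
  assume A: "A \<in> hollow_mats n"
  obtain d :: "nat \<Rightarrow> 'k" where d: "inj_on d {..<n}"
    using ex_inj_on_lessThan[OF assms(1)] .
  define Y where "Y = mat n n (\<lambda>(i, j). A $$ (i, j) / (d i - d j))"
  have Y: "Y \<in> carrier_mat n n"
    by (simp add: Y_def)
  have "A = mat_diag n d * Y - Y * mat_diag n d"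
    using A d unfolding mat_diag_mult_left[OF Y] mat_diag_mult_right[OF Y]
    by (intro eq_matI) (auto simp: Y_def hollow_mats_def inj_on_def divide_simps, (simp add: algebra_simps)?)
  then show ?thesis
    using that Y by (metis mat_diag_dim)
next
  fix c
  assume A: "A = c \<cdot>\<^sub>m 1\<^sub>m n" and c: "of_nat n * c = 0"
  define Z where "Z = upper_shift n (\<lambda>i. of_nat (Suc i) * c)"
  have "A = Z * lower_shift n - lower_shift n * Z"
    unfolding Z_def lower_upper_shift upper_lower_shift A
  proof (rule eq_matI, goal_cases)
    case (1 i j)
    then have ij: "i < n" "j < n"
      by (auto simp: mat_diag_def)
    \<comment> \<open>The last row has no superdiagonal entry; the weight it would carry is \<open>n * c = 0\<close>.\<close>
    have "n = Suc i" if "\<not> Suc i < n"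
      using that ij by auto
    then have last: "(if Suc i < n then of_nat (Suc i) * c else 0) = of_nat (Suc i) * c"
      using c by auto
    have first: "(if i = 0 then 0 else of_nat (Suc (i - 1)) * c) = of_nat i * c"
      by (cases i) auto
    have "(mat_diag n (\<lambda>i. if Suc i < n then of_nat (Suc i) * c else 0) -
          mat_diag n (\<lambda>i. if i = 0 then 0 else of_nat (Suc (i - 1)) * c)) $$ (i, j) =
        (if i = j then (if Suc i < n then of_nat (Suc i) * c else 0) -
          (if i = 0 then 0 else of_nat (Suc (i - 1)) * c) else 0)"
      using ij by (auto simp: mat_diag_def)
    also have "\<dots> = (if i = j then c else 0)"
      unfolding last first by (simp add: algebra_simps)
    finally show ?case
      using ij by simp
  qed (auto simp: mat_diag_def)
  then show ?thesis
    using that Z_def by (metis shift_carrier)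
qed

lemma symmetric_cubic_rotate:
  "cubic n p q r r q p X Y Z = cubic n q r p p r q Y Z X"
  by (simp add: cubic_def algebra_simps)

lemma third_coefficient:
  fixes p q r :: "'k::ring_1"
  shows "p + q + r = 0 \<Longrightarrow> r = - p - q"
  by (simp add: algebra_simps eq_neg_iff_add_eq_0)

text \<open>
  For hollow matrices, take \<open>X = Z = D\<close> diagonal with distinct entries: the value is
  \<open>2p DYD - p (YDD + DDY) = - p [D, [D, Y]]\<close>, whose entry \<open>(i, j)\<close> is \<open>- p (d\<^sub>i - d\<^sub>j)\<^sup>2\<close> times that
  of \<open>Y\<close>.

  This never produces a nonzero scalar matrix. For these, take the lower shift, a diagonal matrix
  and an upper shift with weights \<open>z\<^sub>i\<close>: because \<open>q + r = - p\<close>, the value is diagonal with entries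
  \<open>p (z\<^sub>i (d\<^bsub>i+1\<^esub> - d\<^sub>i) - z\<^bsub>i-1\<^esub> (d\<^sub>i - d\<^bsub>i-1\<^esub>))\<close>. Only consecutive \<open>d\<^sub>i\<close> have to differ, so
  \<open>0, 1, 0, 1, \<dots>\<close> will do, and the weights again are an arithmetic progression up to sign.
\<close>

lemma trace_zero_symmetric_cubic:
  fixes A :: "'k::field mat"
  assumes "infinite (UNIV :: 'k set) \<or> n \<le> card (UNIV :: 'k set)"
    and A: "A \<in> hollow_mats n \<or> (\<exists>c. A = c \<cdot>\<^sub>m 1\<^sub>m n \<and> of_nat n * c = 0)"
    and p: "p \<noteq> 0" and sum: "p + q + r = 0"
  obtains X Y Z where "X \<in> carrier_mat n n" "Y \<in> carrier_mat n n" "Z \<in> carrier_mat n n"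
    "A = cubic n p q r r q p X Y Z"
  using A
proof (elim disjE exE conjE)
  assume A: "A \<in> hollow_mats n"
  obtain d :: "nat \<Rightarrow> 'k" where d: "inj_on d {..<n}"
    using ex_inj_on_lessThan[OF assms(1)] .
  let ?D = "mat_diag n d"
  define y where "y i j = - (A $$ (i, j) / (p * (d i - d j) ^ 2))" for i j
  define Y where "Y = mat n n (\<lambda>(i, j). y i j)"
  have Y: "Y \<in> carrier_mat n n"
    by (simp add: Y_def)
  have "A = cubic n p q r r q p ?D Y ?D"
  proof (rule eq_matI, goal_cases)
    case (1 i j)
    then have ij: "i < n" "j < n"
      by (auto simp: cubic_def)
    have prods: "(?D * Y * ?D) $$ (i, j) = d i * y i j * d j"
      "(Y * ?D * ?D) $$ (i, j) = y i j * d j * d j" "(?D * ?D * Y) $$ (i, j) = d i * d i * y i j"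
      using ij Y
      by (simp_all add: mat_diag_mult_left[of _ n n] mat_diag_mult_right[of _ n n] Y_def mult.assoc)
    have "cubic n p q r r q p ?D Y ?D $$ (i, j) = - p * (d i - d j) ^ 2 * y i j"
      using ij
      by (simp add: cubic_def prods third_coefficient[OF sum] algebra_simps power2_eq_square
          del: mat_diag_diag index_mult_mat)
    also have "\<dots> = A $$ (i, j)"
    proof (cases "i = j")
      case True
      then show ?thesis
        using A ij by (simp add: hollow_mats_def)
    next
      case False
      then have "d i - d j \<noteq> 0"
        using d ij by (auto simp: inj_on_def)
      then show ?thesis
        using p by (simp add: y_def)
    qed
    finally show ?case
      by simp
  qed (use A in \<open>auto simp: cubic_def hollow_mats_def\<close>)
  then show ?thesis
    using that[of ?D Y ?D] Y by simp
next
  fix c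
  assume A: "A = c \<cdot>\<^sub>m 1\<^sub>m n" and c: "of_nat n * c = 0"
  define d :: "nat \<Rightarrow> 'k" where "d i = of_bool (odd i)" for i
  define z where "z i = (- 1) ^ i * (of_nat (Suc i) * c / p)" for i
  let ?D = "mat_diag n d" and ?L = "lower_shift n :: 'k mat" and ?U = "upper_shift n z"
  have "A = cubic n p q r r q p ?L ?D ?U"
  proof (rule eq_matI, goal_cases)
    case (1 i j)
    then have ij: "i < n" "j < n"
      by (auto simp: cubic_def)
    let ?z' = "if i = 0 then 0 else z (i - 1)" and ?z = "if Suc i < n then z i else 0"
    let ?d' = "d (i - 1)" and ?d = "d i" and ?e = "d (Suc i)"
    have ass: "?L * ?D * ?U = ?L * (?D * ?U)" "?D * ?L * ?U = ?D * (?L * ?U)"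
      "?D * ?U * ?L = ?D * (?U * ?L)"
      by (auto intro!: assoc_mult_mat[of _ n n _ n _ n])
    have prods: "?L * ?D * ?U = mat_diag n (\<lambda>i. if i = 0 then 0 else d (i - 1) * z (i - 1))"
      "?D * ?U * ?L = mat_diag n (\<lambda>i. d i * (if Suc i < n then z i else 0))"
      "?U * ?L * ?D = mat_diag n (\<lambda>i. (if Suc i < n then z i else 0) * d i)"
      "?D * ?L * ?U = mat_diag n (\<lambda>i. d i * (if i = 0 then 0 else z (i - 1)))"
      "?L * ?U * ?D = mat_diag n (\<lambda>i. (if i = 0 then 0 else z (i - 1)) * d i)"
      "?U * ?D * ?L = mat_diag n (\<lambda>i. if Suc i < n then z i * d (Suc i) else 0)"
      unfolding ass by (simp_all add: mat_diag_upper_shift lower_upper_shift upper_lower_shift)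
    have "cubic n p q r r q p ?L ?D ?U $$ (i, j) =
        (if i = j then p * (?z' * (?d' - ?d) + ?z * (?e - ?d)) else 0)"
      using ij unfolding cubic_def prods
      by (auto simp: mat_diag_def third_coefficient[OF sum] algebra_simps)
    also have "\<dots> = (if i = j then c else 0)"
    proof -
      \<comment> \<open>In the last row this holds because \<open>z (n - 1)\<close> is a multiple of \<open>n * c = 0\<close>.\<close>
      have 1: "?z = z i"
        using ij c p by (cases "n = Suc i") (auto simp: z_def)
      have 2: "p * (z i * (?e - ?d)) = of_nat (Suc i) * c"
        using p by (cases "even i") (auto simp: z_def d_def)
      have 3: "p * (?z' * (?d' - ?d)) = - (of_nat i * c)"
        using p by (cases "even i"; cases i) (auto simp: z_def d_def)
      show ?thesis
        unfolding 1 distrib_left 2 3 by (simp add: algebra_simps)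
    qed
    finally show ?case
      using ij A by simp
  qed (use A in \<open>auto simp: cubic_def\<close>)
  then show ?thesis
    using that[of ?L ?D ?U] by simp
qed

section \<open>The image of a multilinear polynomial of degree three\<close>

text \<open>With one variable specialised to the identity, three of the six words become \<open>XY\<close> and the
  other three \<open>YX\<close>. The two resulting coefficients are opposite since all six add up to zero.\<close>

lemma cubic_one:
  fixes X Y :: "'k::comm_ring_1 mat"
  assumes "X \<in> carrier_mat n n" "Y \<in> carrier_mat n n" "p + q + r = 0" "u + v + w = 0"
  shows "cubic n p q r u v w (1\<^sub>m n) X Y = (u - r) \<cdot>\<^sub>m (X * Y - Y * X)"
    "cubic n p q r u v w X (1\<^sub>m n) Y = (p - w) \<cdot>\<^sub>m (X * Y - Y * X)"
    "cubic n p q r u v w X Y (1\<^sub>m n) = (v - q) \<cdot>\<^sub>m (X * Y - Y * X)"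
proof -
  note rw = third_coefficient[OF assms(3)] third_coefficient[OF assms(4)]
  show "cubic n p q r u v w (1\<^sub>m n) X Y = (u - r) \<cdot>\<^sub>m (X * Y - Y * X)"
    "cubic n p q r u v w X (1\<^sub>m n) Y = (p - w) \<cdot>\<^sub>m (X * Y - Y * X)"
    "cubic n p q r u v w X Y (1\<^sub>m n) = (v - q) \<cdot>\<^sub>m (X * Y - Y * X)"
    using assms(1,2)
    by (auto intro!: eq_matI simp: cubic_def rw algebra_simps simp del: index_mult_mat(1))
qed

lemma trace_zero_cubic:
  fixes A :: "'k::field mat"
  assumes K: "infinite (UNIV :: 'k set) \<or> n \<le> card (UNIV :: 'k set)"
    and A: "A \<in> hollow_mats n \<or> (\<exists>c. A = c \<cdot>\<^sub>m 1\<^sub>m n \<and> of_nat n * c = 0)"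
    and sums: "p + q + r = 0" "u + v + w = 0"
    and nz: "\<not> (p = 0 \<and> q = 0 \<and> r = 0 \<and> u = 0 \<and> v = 0 \<and> w = 0)"
  obtains X Y Z where "X \<in> carrier_mat n n" "Y \<in> carrier_mat n n" "Z \<in> carrier_mat n n"
    "A = cubic n p q r u v w X Y Z"
proof (cases "u = r \<and> p = w \<and> v = q")
  case False
  obtain X Y where XY: "X \<in> carrier_mat n n" "Y \<in> carrier_mat n n" "A = X * Y - Y * X"
    using trace_zero_commutator[OF K A] .
  \<comment> \<open>The nonzero factor in \<open>cubic_one\<close> is absorbed into \<open>Y\<close>.\<close>
  have comm: "A = c \<cdot>\<^sub>m (X * (inverse c \<cdot>\<^sub>m Y) - (inverse c \<cdot>\<^sub>m Y) * X)" if "c \<noteq> 0" for c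
  proof -
    have "X * (inverse c \<cdot>\<^sub>m Y) = inverse c \<cdot>\<^sub>m (X * Y)" "(inverse c \<cdot>\<^sub>m Y) * X = inverse c \<cdot>\<^sub>m (Y * X)"
      using XY by (auto simp: mult_smult_distrib mult_smult_assoc_mat)
    then show ?thesis
      using XY that
      by (auto intro!: eq_matI simp: right_diff_distrib mult.assoc[symmetric] simp del: index_mult_mat(1))
  qed
  have carr: "inverse c \<cdot>\<^sub>m Y \<in> carrier_mat n n" for c
    using XY by simp
  from False consider "u - r \<noteq> 0" | "p - w \<noteq> 0" | "v - q \<noteq> 0"
    by auto
  then show ?thesis
  proof cases
    case 1
    then show ?thesis
      using that[OF one_carrier_mat XY(1) carr] comm cubic_one(1)[OF XY(1) carr sums] by metis
  next
    case 2
    then show ?thesis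
      using that[OF XY(1) one_carrier_mat carr] comm cubic_one(2)[OF XY(1) carr sums] by metis
  next
    case 3
    then show ?thesis
      using that[OF XY(1) carr one_carrier_mat] comm cubic_one(3)[OF XY(1) carr sums] by metis
  qed
next
  case True
  then have eq: "u = r" "v = q" "w = p"
    by auto
  note rotate = symmetric_cubic_rotate[of n]
  from nz eq consider "p \<noteq> 0" | "q \<noteq> 0" | "r \<noteq> 0"
    by auto
  then show ?thesis
  proof cases
    case 1
    then show ?thesis
      using trace_zero_symmetric_cubic[OF K A 1 sums(1)] that unfolding eq by metis
  next
    case 2
    have "q + r + p = 0"
      using sums by (simp add: algebra_simps)
    from trace_zero_symmetric_cubic[OF K A 2 this]
    obtain X Y Z where "X \<in> carrier_mat n n" "Y \<in> carrier_mat n n" "Z \<in> carrier_mat n n"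
      "A = cubic n q r p p r q X Y Z" .
    then show ?thesis
      using that[of Z X Y] unfolding eq by (simp add: rotate[of p q r Z])
  next
    case 3
    have "r + p + q = 0"
      using sums by (simp add: algebra_simps)
    from trace_zero_symmetric_cubic[OF K A 3 this]
    obtain X Y Z where "X \<in> carrier_mat n n" "Y \<in> carrier_mat n n" "Z \<in> carrier_mat n n"
      "A = cubic n r p q q p r X Y Z" .
    then show ?thesis
      using that[of Y Z X] rotate[of r p q X Y Z] unfolding eq by simp
  qed
qed

text \<open>The units \<open>E\<^sub>0\<^sub>1, E\<^sub>1\<^sub>0, E\<^sub>0\<^sub>0\<close> multiply to \<open>E\<^sub>0\<^sub>0\<close> in this order but to \<open>0\<close> after a swap of the
  first two, so they separate the two terms of \<open>mat_trace_cubic\<close>.\<close>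

lemma coefficient_sums_eq_0:
  fixes p q r u v w :: "'k::comm_ring_1"
  assumes n: "n \<ge> 2"
    and tr: "\<And>X Y Z. X \<in> carrier_mat n n \<Longrightarrow> Y \<in> carrier_mat n n \<Longrightarrow> Z \<in> carrier_mat n n \<Longrightarrow>
      mat_trace (cubic n p q r u v w X Y Z) = 0"
  shows "p + q + r = 0" "u + v + w = 0"
proof -
  define E :: "nat \<Rightarrow> nat \<Rightarrow> 'k mat" where
    "E k l = mat n n (\<lambda>(i, j). if i = k \<and> j = l then 1 else 0)" for k l
  have E [simp]: "E k l \<in> carrier_mat n n" for k l
    by (simp add: E_def)
  have mult: "E k l * E l' m = (if l = l' then E k m else 0\<^sub>m n n)" if "l < n" for k l l' m
  proof (rule eq_matI, goal_cases)
    case (1 i j)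
    then have ij: "i < n" "j < n"
      by (auto simp: E_def split: if_splits)
    have "(E k l * E l' m) $$ (i, j) = (\<Sum>x<n. E k l $$ (i, x) * E l' m $$ (x, j))"
      using ij by (rule index_mult_mat_sum[OF E E])
    also have "\<dots> = (\<Sum>x<n. if x = l then (if i = k \<and> l = l' \<and> j = m then 1 else 0) else 0)"
      using ij by (intro sum.cong) (auto simp: E_def)
    also have "\<dots> = (if l = l' then E k m else 0\<^sub>m n n) $$ (i, j)"
      using ij that by (subst sum.delta) (auto simp: E_def)
    finally show ?case .
  qed (auto simp: E_def)
  have tr0: "mat_trace (0\<^sub>m n n :: 'k mat) = 0"
    by (simp add: mat_trace_def)
  have trE: "mat_trace (E 0 0) = 1"
    using n by (simp add: mat_trace_def E_def)
  have l: "0 < n" "Suc 0 < n"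
    using n by auto
  show "p + q + r = 0"
    using tr[of "E 0 1" "E 1 0" "E 0 0"] mat_trace_cubic[of "E 0 1" n "E 1 0" "E 0 0" p q r u v w] l
    by (simp add: mult tr0 trE)
  show "u + v + w = 0"
    using tr[of "E 1 0" "E 0 1" "E 0 0"] mat_trace_cubic[of "E 1 0" n "E 0 1" "E 0 0" p q r u v w] l
    by (simp add: mult tr0 trE)
qed

theorem corollary15:
  fixes n :: nat
    and a :: "(3 \<Rightarrow> 3) \<Rightarrow> 'k::field"
    and f :: "(3, 'k) free_algebra"
  assumes "n \<ge> 2"
    and "infinite (UNIV :: 'k set) \<or> n \<le> card (UNIV :: 'k set)"
    and "f = multilinear3 a"
    and "f \<noteq> 0"
  shows "mat_values n f = trace_zero_mats n \<longleftrightarrow>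
    (\<Sum>\<sigma> | \<sigma> permutes UNIV. a \<sigma>) = 0 \<and>
    (\<Sum>\<sigma> | \<sigma> permutes UNIV \<and> evenperm \<sigma>. a \<sigma>) = 0"
proof -
  let ?p = "a id" and ?q = "a (t12 \<circ> t23)" and ?r = "a (t23 \<circ> t12)"
  let ?u = "a t12" and ?v = "a t23" and ?w = "a t13"
  have sums: "(\<Sum>\<sigma> | \<sigma> permutes UNIV. a \<sigma>) = 0 \<and>
      (\<Sum>\<sigma> | \<sigma> permutes UNIV \<and> evenperm \<sigma>. a \<sigma>) = 0 \<longleftrightarrow>
      ?p + ?q + ?r = 0 \<and> ?u + ?v + ?w = 0"
    unfolding sum_permutations_3 sum_even_permutations_3 by (auto simp: add.assoc[symmetric])
  show ?thesis
    unfolding sums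
  proof
    assume img: "mat_values n f = trace_zero_mats n"
    have "mat_trace (cubic_of n a X Y Z) = 0"
      if "X \<in> carrier_mat n n" "Y \<in> carrier_mat n n" "Z \<in> carrier_mat n n" for X Y Z
      using cubic_in_mat_values[OF that, of a] img assms(3) by (simp add: trace_zero_mats_def)
    then show "?p + ?q + ?r = 0 \<and> ?u + ?v + ?w = 0"
      using coefficient_sums_eq_0[OF assms(1), of ?p ?q ?r ?u ?v ?w] by blast
  next
    assume s: "?p + ?q + ?r = 0 \<and> ?u + ?v + ?w = 0"
    have normal: "A \<in> mat_values n f"
      if A: "A \<in> hollow_mats n \<or> (\<exists>c. A = c \<cdot>\<^sub>m 1\<^sub>m n \<and> of_nat n * c = 0)" for A
    proof -
      have "\<not> (?p = 0 \<and> ?q = 0 \<and> ?r = 0 \<and> ?u = 0 \<and> ?v = 0 \<and> ?w = 0)"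
        using multilinear3_eq_0[of a] assms(3,4) by blast
      then obtain X Y Z where "X \<in> carrier_mat n n" "Y \<in> carrier_mat n n" "Z \<in> carrier_mat n n"
        "A = cubic_of n a X Y Z"
        using trace_zero_cubic[OF assms(2) A] s by metis
      then show ?thesis
        using cubic_in_mat_values assms(3) by metis
    qed
    show "mat_values n f = trace_zero_mats n"
    proof (intro equalityI subsetI)
      fix A
      assume "A \<in> mat_values n f"
      then obtain B where B: "\<And>i. B i \<in> carrier_mat n n" and A: "A = eval_mat n B f"
        by (auto simp: mat_values_def)
      have "A = cubic_of n a (B 1) (B 2) (B 3)"
        using A eval_mat_multilinear3[of B n a, OF B] assms(3) by simp
      then have "mat_trace A = 0"
        using mat_trace_cubic[OF B B B] s by simp
      then show "A \<in> trace_zero_mats n"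
        using A by (simp add: trace_zero_mats_def)
    next
      fix A :: "'k mat"
      assume A: "A \<in> trace_zero_mats n"
      have "n > 0"
        using assms(1) by simp
      from this A show "A \<in> mat_values n f"
      proof (cases rule: trace_zero_similar_hollow_or_scalar)
        case (1 A')
        then show ?thesis
          using mat_values_similar normal by blast
      next
        case (2 c)
        then show ?thesis
          using normal by blast
      qed
    qed
  qed
qed

end
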